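(* Suppose $\max\left\{\frac{|\delta+\mu|}{1+\beta},\frac{|\delta-\mu|}{1-\beta}\right\}\rho(G)<1$ and $\mu<\beta\delta$. The following statements are true for the optimal solution of $\widetilde{\boldsymbol P}$. (i) If the policy $p^{(0* )}\in\mathbb R^c$ defined by $$p^{(0* )}_{(\ell)}:=\begin{cases}\tilde p^{\max}_{(\ell)}&\text{if }\tilde p^{\max}_{(\ell)}\ge\frac{v_{(\ell)}}{q_{(\ell)}}-p^{A0}_{(\ell)},\\ p^{A0}_{(\ell)}&\text{otherwise}\end{cases}$$ satisfies $\sum_{\ell=1}^cb_{\Delta(\ell)}p^{(0* )}_{(\ell)}\ge k_0$, then $p^{(0* )}$ is an optimal solution of $\widetilde{\boldsymbol P}$. (ii) For all $\ell\in[c]$ such that $\tilde p^{\max}_{(\ell)}\ge\frac{v_{(\ell)}}{q_{(\ell)}}-p^{A0}_{(\ell)}$, there exists an optimal solution $p^*$ of $\widetilde{\boldsymbol P}$ with $p^*_{(\ell)}=p^{(0* )}_{(\ell)}=\tilde p^{\max}_{(\ell)}$. (iii) If $p^*$ is an optimal solution of $\widetilde{\boldsymbol P}$, then $p^*_{(\ell)}\in\{p^{A0}_{(\ell)},\tilde p^{\max}_{(\ell)}\}$ for at least $c-1$ values of the index $\ell\in[c]$.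
   Context: $G\in\{0,1\}^{n\times n}$ is the symmetric, zero-diagonal adjacency matrix of an undirected graph on $n$ agents with $c$ connected components having vertex sets $V_{(1)},\dots,V_{(c)}$ and component adjacency matrices $G_{(1)},\dots,G_{(c)}$ ($G$ is block diagonal). $\rho(G)$ is the spectral radius; $\beta\in(0,1)$, $\delta>0$, $\mu>0$; $[c]=\{1,\dots,c\}$; $\mathbf 1$ is the all-ones vector. Let $M^+:=((1+\beta)I-(\delta+\mu)G)^{-1}$, $M^-:=((1-\beta)I-(\delta-\mu)G)^{-1}$, $b_\Delta:=(M^--M^+)\mathbf 1$, $b_{\Delta(\ell)}:=\sum_{i\in V_{(\ell)}}b_{\Delta i}$. Pre-intervention prices are $p^{A0},p^{B0}\in\mathbb R^n_{\ge0}$, with $p^{A0}$ uniform in each component (common value $p^{A0}_{(\ell)}$); $p^{B0}_{(\ell)}$ denotes the restriction of $p^{B0}$ to $V_{(\ell)}$. Let $k_0:=\mathbf 1^\top(M^++M^-)^\top p^{B0}-2\tau^B$ with tolerance $\tau^B\ge0$. For $\ell\in[c]$ let $M^{\pm}_{(\ell)}:=((1\pm\beta)I-(\delta\pm\mu)G_{(\ell)})^{-1}$, $Q_{(\ell)}:=(1+\beta)(M^+_{(\ell)})^2+(1-\beta)(M^-_{(\ell)})^2$, $R_{(\ell)}:=(1-\beta)(M^-_{(\ell)})^2-(1+\beta)(M^+_{(\ell)})^2$, $q_{(\ell)}:=\mathbf 1^\top Q_{(\ell)}\mathbf 1$, $v_{(\ell)}:=2\,\mathbf 1^\top R_{(\ell)}p^{B0}_{(\ell)}$.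 Problem $\widetilde{\boldsymbol P}$: maximize over $p^A=(p^A_{(\ell)})_{\ell\in[c]}\in\mathbb R^c$ the function $\sum_{\ell=1}^c\big(q_{(\ell)}(p^A_{(\ell)})^2-v_{(\ell)}p^A_{(\ell)}\big)$ subject to $\sum_{\ell=1}^cb_{\Delta(\ell)}p^A_{(\ell)}\ge k_0$ and $p^{A0}_{(\ell)}\le p^A_{(\ell)}\le\tilde p^{\max}_{(\ell)}$ for all $\ell\in[c]$, where $\tilde p^{\max}\in\mathbb R^c$ is a given vector of upper bounds with $\tilde p^{\max}_{(\ell)}\ge p^{A0}_{(\ell)}$. $\widetilde{\boldsymbol P}$ is assumed feasible. *)

theory Defs
  imports
    "Jordan_Normal_Form.Spectral_Radius"
    "Jordan_Normal_Form.Gauss_Jordan_Elimination"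
    "Jordan_Normal_Form.DL_Submatrix"
begin

(* Agents are 0, ..., n - 1 and components are numbered 0, ..., c - 1. *)

definition adjacency_mat :: "nat \<Rightarrow> real mat \<Rightarrow> bool" where
  "adjacency_mat n G \<longleftrightarrow>
     G \<in> carrier_mat n n \<and>
     (\<forall>i<n. \<forall>j<n. G $$ (i, j) \<in> {0, 1}) \<and>
     transpose_mat G = G \<and>
     (\<forall>i<n. G $$ (i, i) = 0)"

definition edges :: "real mat \<Rightarrow> (nat \<times> nat) set" where
  "edges G = {(i, j). i < dim_row G \<and> j < dim_col G \<and> G $$ (i, j) = 1}"

definition components :: "real mat \<Rightarrow> nat set set" where
  "components G =
     {..<dim_row G} // {(i, j). i < dim_row G \<and> j < dim_row G \<and> (i, j) \<in> (edges G)\<^sup>*}"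

definition real_spectral_radius :: "real mat \<Rightarrow> real" where
  "real_spectral_radius A = spectral_radius (map_mat complex_of_real A)"

definition ones :: "nat \<Rightarrow> real vec" where
  "ones m = vec m (\<lambda>_. 1)"

(* Unspecified for singular matrices. *)
definition mat_inv :: "real mat \<Rightarrow> real mat" where
  "mat_inv A = the (mat_inverse A)"

(* A is either the whole adjacency matrix or the one of a single component. *)

definition M_plus :: "real \<Rightarrow> real \<Rightarrow> real \<Rightarrow> real mat \<Rightarrow> real mat" where
  "M_plus \<beta> \<delta> \<mu> A =
     mat_inv ((1 + \<beta>) \<cdot>\<^sub>m 1\<^sub>m (dim_row A) - (\<delta> + \<mu>) \<cdot>\<^sub>m A)"

definition M_minus :: "real \<Rightarrow> real \<Rightarrow> real \<Rightarrow> real mat \<Rightarrow> real mat" where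
  "M_minus \<beta> \<delta> \<mu> A =
     mat_inv ((1 - \<beta>) \<cdot>\<^sub>m 1\<^sub>m (dim_row A) - (\<delta> - \<mu>) \<cdot>\<^sub>m A)"

definition Q_mat :: "real \<Rightarrow> real \<Rightarrow> real \<Rightarrow> real mat \<Rightarrow> real mat" where
  "Q_mat \<beta> \<delta> \<mu> A =
     (1 + \<beta>) \<cdot>\<^sub>m (M_plus \<beta> \<delta> \<mu> A ^\<^sub>m 2) + (1 - \<beta>) \<cdot>\<^sub>m (M_minus \<beta> \<delta> \<mu> A ^\<^sub>m 2)"

definition R_mat :: "real \<Rightarrow> real \<Rightarrow> real \<Rightarrow> real mat \<Rightarrow> real mat" where
  "R_mat \<beta> \<delta> \<mu> A =
     (1 - \<beta>) \<cdot>\<^sub>m (M_minus \<beta> \<delta> \<mu> A ^\<^sub>m 2) - (1 + \<beta>) \<cdot>\<^sub>m (M_plus \<beta> \<delta> \<mu> A ^\<^sub>m 2)"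

definition b_Delta :: "real \<Rightarrow> real \<Rightarrow> real \<Rightarrow> real mat \<Rightarrow> real vec" where
  "b_Delta \<beta> \<delta> \<mu> G = (M_minus \<beta> \<delta> \<mu> G - M_plus \<beta> \<delta> \<mu> G) *\<^sub>v ones (dim_row G)"

definition k_zero :: "real \<Rightarrow> real \<Rightarrow> real \<Rightarrow> real mat \<Rightarrow> real vec \<Rightarrow> real \<Rightarrow> real" where
  "k_zero \<beta> \<delta> \<mu> G pB0 \<tau> =
     ones (dim_row G) \<bullet>
       (transpose_mat (M_plus \<beta> \<delta> \<mu> G + M_minus \<beta> \<delta> \<mu> G) *\<^sub>v pB0) - 2 * \<tau>"

(* S is the vertex set of a component. The indices in S are listed in increasing order by
   pick S, which is also the order used by submatrix. *)

definition restrict_mat :: "real mat \<Rightarrow> nat set \<Rightarrow> real mat" where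
  "restrict_mat G S = submatrix G S S"

definition restrict_vec :: "real vec \<Rightarrow> nat set \<Rightarrow> real vec" where
  "restrict_vec x S = vec (card S) (\<lambda>i. x $ pick S i)"

definition b_comp :: "real \<Rightarrow> real \<Rightarrow> real \<Rightarrow> real mat \<Rightarrow> nat set \<Rightarrow> real" where
  "b_comp \<beta> \<delta> \<mu> G S = (\<Sum>i\<in>S. b_Delta \<beta> \<delta> \<mu> G $ i)"

definition q_comp :: "real \<Rightarrow> real \<Rightarrow> real \<Rightarrow> real mat \<Rightarrow> nat set \<Rightarrow> real" where
  "q_comp \<beta> \<delta> \<mu> G S =
     ones (card S) \<bullet> (Q_mat \<beta> \<delta> \<mu> (restrict_mat G S) *\<^sub>v ones (card S))"

definition v_comp :: "real \<Rightarrow> real \<Rightarrow> real \<Rightarrow> real mat \<Rightarrow> real vec \<Rightarrow> nat set \<Rightarrow> real" where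
  "v_comp \<beta> \<delta> \<mu> G pB0 S =
     2 * (ones (card S) \<bullet> (R_mat \<beta> \<delta> \<mu> (restrict_mat G S) *\<^sub>v restrict_vec pB0 S))"

(* A box-constrained separable quadratic program with one linear constraint:
   maximise sum q l * (p l)^2 - v l * p l subject to sum b l * p l >= k and lo <= p <= hi. *)

definition objective :: "nat \<Rightarrow> (nat \<Rightarrow> real) \<Rightarrow> (nat \<Rightarrow> real) \<Rightarrow> real vec \<Rightarrow> real" where
  "objective c q v p = (\<Sum>l<c. q l * (p $ l)\<^sup>2 - v l * p $ l)"

definition feasible_set ::
  "nat \<Rightarrow> (nat \<Rightarrow> real) \<Rightarrow> real \<Rightarrow> real vec \<Rightarrow> real vec \<Rightarrow> real vec set" where
  "feasible_set c b k lo hi =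
     {p \<in> carrier_vec c. (\<Sum>l<c. b l * p $ l) \<ge> k \<and> (\<forall>l<c. lo $ l \<le> p $ l \<and> p $ l \<le> hi $ l)}"

definition optimal_on :: "real vec set \<Rightarrow> (real vec \<Rightarrow> real) \<Rightarrow> real vec \<Rightarrow> bool" where
  "optimal_on F f p \<longleftrightarrow> p \<in> F \<and> (\<forall>p'\<in>F. f p' \<le> f p)"

(* In what follows V l is the vertex set of component l, and pA0c and pmax are vectors indexed
   by the components. *)

definition P_feasible ::
  "nat \<Rightarrow> real \<Rightarrow> real \<Rightarrow> real \<Rightarrow> real mat \<Rightarrow> (nat \<Rightarrow> nat set) \<Rightarrow> real vec \<Rightarrow> real \<Rightarrow>
   real vec \<Rightarrow> real vec \<Rightarrow> real vec set" where
  "P_feasible c \<beta> \<delta> \<mu> G V pB0 \<tau> pA0c pmax =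
     feasible_set c (\<lambda>l. b_comp \<beta> \<delta> \<mu> G (V l)) (k_zero \<beta> \<delta> \<mu> G pB0 \<tau>) pA0c pmax"

definition P_optimal ::
  "nat \<Rightarrow> real \<Rightarrow> real \<Rightarrow> real \<Rightarrow> real mat \<Rightarrow> (nat \<Rightarrow> nat set) \<Rightarrow> real vec \<Rightarrow> real \<Rightarrow>
   real vec \<Rightarrow> real vec \<Rightarrow> real vec \<Rightarrow> bool" where
  "P_optimal c \<beta> \<delta> \<mu> G V pB0 \<tau> pA0c pmax =
     optimal_on (P_feasible c \<beta> \<delta> \<mu> G V pB0 \<tau> pA0c pmax)
       (objective c (\<lambda>l. q_comp \<beta> \<delta> \<mu> G (V l)) (\<lambda>l. v_comp \<beta> \<delta> \<mu> G pB0 (V l)))"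

definition p_zero_star ::
  "nat \<Rightarrow> real \<Rightarrow> real \<Rightarrow> real \<Rightarrow> real mat \<Rightarrow> (nat \<Rightarrow> nat set) \<Rightarrow> real vec \<Rightarrow>
   real vec \<Rightarrow> real vec \<Rightarrow> real vec" where
  "p_zero_star c \<beta> \<delta> \<mu> G V pB0 pA0c pmax =
     vec c (\<lambda>l. if pmax $ l \<ge> v_comp \<beta> \<delta> \<mu> G pB0 (V l) / q_comp \<beta> \<delta> \<mu> G (V l) - pA0c $ l
                then pmax $ l else pA0c $ l)"

end

theory Submission
  imports "HOL-Analysis.Function_Topology" Defs
begin

text \<open>The problem maximizes a separable quadratic over a box cut by one linear inequality, and the three
claims only need two signs: every \<open>q\<^sub>l\<close> is positive and every \<open>b\<^sub>l\<close> is nonnegative. Given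
these, (i) holds because a strictly convex quadratic on an interval is maximal at an endpoint, the
upper one exactly when \<open>lo + hi \<ge> v / q\<close>; (ii) holds because raising a coordinate of an optimal
point to an upper bound of this kind respects the constraint and does not lower the objective; and
(iii) holds because two coordinates strictly inside their intervals leave a line segment along which
the constraint is constant and the objective strictly convex. These are the lemmas
\<open>endpoint_choice_optimal\<close>, \<open>optimal_with_coordinate_at_upper_bound\<close> and
\<open>optimal_card_endpoint_coordinates\<close>.

For \<open>q\<^sub>l\<close> (\<open>q_comp_pos\<close>): the matrices \<open>M\<^sup>+\<close> and \<open>M\<^sup>-\<close> of a component are symmetric, so
\<open>q\<^sub>l\<close> is \<open>(1 + \<beta>) \<bar>M\<^sup>+ 1\<bar>\<^sup>2 + (1 - \<beta>) \<bar>M\<^sup>- 1\<bar>\<^sup>2\<close>, and \<open>M\<^sup>+ 1\<close> does not vanish. The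
inverses exist for the component because a kernel vector of the shifted component matrix, extended
by zero, would be an eigenvector of the whole of \<open>G\<close> with an eigenvalue beyond the spectral radius.

For \<open>b\<^sub>l\<close> (\<open>b_Delta_nonneg\<close>): \<open>x = M\<^sup>- 1\<close> and \<open>y = M\<^sup>+ 1\<close> solve
\<open>x = 1 / (1 - \<beta>) + a' G x\<close> and \<open>y = 1 / (1 + \<beta>) + a G y\<close> with \<open>a = (\<delta> + \<mu>) / (1 + \<beta>)\<close> and
\<open>a' = (\<delta> - \<mu>) / (1 - \<beta>)\<close>, and \<open>\<mu> < \<beta> \<delta>\<close> says precisely that \<open>a < a'\<close>. A comparison
principle (\<open>nonneg_of_supersolution\<close>: \<open>z \<ge> a G z\<close> implies \<open>z \<ge> 0\<close> when \<open>a \<rho>(G) < 1\<close>) applied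
first to \<open>x\<close> and then to \<open>x - y\<close> gives \<open>x \<ge> y\<close>, entry by entry.\<close>

section \<open>Separable convex maximization under one linear constraint\<close>

text \<open>The objective gains \<open>(hi - x) (q (hi + x) - v)\<close> in moving from \<open>x\<close> to \<open>hi\<close>, and the
second factor is smallest at \<open>x = lo\<close>. At the left end the roles are reversed.\<close>

lemma quadratic_le_right_end:
  fixes q v lo hi x :: real
  assumes "q > 0" "lo \<le> x" "x \<le> hi" "v / q - lo \<le> hi"
  shows "q * x\<^sup>2 - v * x \<le> q * hi\<^sup>2 - v * hi"
proof -
  have "v \<le> q * (hi + lo)"
    using assms by (simp add: field_simps)
  also have "\<dots> \<le> q * (hi + x)"
    using assms by simp
  finally have "0 \<le> (hi - x) * (q * (hi + x) - v)"
    using assms by simp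
  then show ?thesis
    by (simp add: algebra_simps power2_eq_square)
qed

lemma quadratic_le_left_end:
  fixes q v lo hi x :: real
  assumes "q > 0" "lo \<le> x" "x \<le> hi" "hi < v / q - lo"
  shows "q * x\<^sup>2 - v * x \<le> q * lo\<^sup>2 - v * lo"
proof -
  have "q * (x + lo) \<le> q * (hi + lo)"
    using assms by simp
  also have "\<dots> \<le> v"
    using assms by (simp add: field_simps)
  finally have "0 \<le> (x - lo) * (v - q * (x + lo))"
    using assms by simp
  then show ?thesis
    by (simp add: algebra_simps power2_eq_square)
qed

text \<open>The feasible set is compact and the objective continuous. To have a topology at hand for every
\<open>c\<close>, vectors are identified with the functions on \<open>nat\<close> that vanish from \<open>c\<close> on; among these the
box is compact by Tychonoff's theorem.\<close>

lemma optimal_exists: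
  assumes "feasible_set c b k lo hi \<noteq> {}"
  shows "\<exists>p. optimal_on (feasible_set c b k lo hi) (objective c q v) p"
proof -
  define box where "box = PiE UNIV (\<lambda>l. if l < c then {lo $ l..hi $ l} else {0::real})"
  define F where "F = {x \<in> box. k \<le> (\<Sum>l<c. b l * x l)}"
  define f where "f x = (\<Sum>l<c. q l * (x l)\<^sup>2 - v l * x l)" for x :: "nat \<Rightarrow> real"
  have F_iff: "x \<in> F \<longleftrightarrow> vec c x \<in> feasible_set c b k lo hi \<and> (\<forall>l\<ge>c. x l = 0)" for x
    unfolding F_def box_def feasible_set_def PiE_UNIV_domain Pi_def
    by (fastforce split: if_splits simp: not_less)
  have "compactin (product_topology (\<lambda>_. euclidean) UNIV) box"
    unfolding box_def by (rule compactin_PiE[THEN iffD2]) auto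
  then have "compact box"
    by (simp add: euclidean_product_topology)
  have coord: "continuous_on A (\<lambda>x. x i)" for A :: "(nat \<Rightarrow> real) set" and i
    by (rule continuous_on_subset[OF continuous_on_product_coordinates]) simp
  have "closed {x. k \<le> (\<Sum>l<c. b l * x l)}"
    by (intro closed_Collect_le continuous_intros coord)
  with \<open>compact box\<close> have "compact F"
    unfolding F_def by (metis Collect_conj_eq Collect_mem_eq compact_Int_closed)
  moreover have "F \<noteq> {}"
  proof -
    obtain p where p: "p \<in> feasible_set c b k lo hi"
      using assms by blast
    have "vec c (\<lambda>l. if l < c then p $ l else 0) = p"
      using p by (intro eq_vecI) (auto simp: feasible_set_def)
    with p have "(\<lambda>l. if l < c then p $ l else 0) \<in> F"
      by (simp add: F_iff)
    then show ?thesis by blast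
  qed
  moreover have "continuous_on F f"
    unfolding f_def by (intro continuous_intros coord)
  ultimately obtain x where x: "x \<in> F" and x_max: "\<And>y. y \<in> F \<Longrightarrow> f y \<le> f x"
    using continuous_attains_sup[of F f] by auto
  have "objective c q v p \<le> objective c q v (vec c x)" if p: "p \<in> feasible_set c b k lo hi" for p
  proof -
    define y where "y = (\<lambda>l. if l < c then p $ l else 0)"
    have "vec c y = p"
      using p unfolding y_def by (intro eq_vecI) (auto simp: feasible_set_def)
    moreover from this p have "y \<in> F"
      by (simp add: F_iff y_def)
    ultimately show ?thesis
      using x_max[of y] by (auto simp: objective_def f_def y_def)
  qed
  with x show ?thesis
    unfolding optimal_on_def F_iff by blast
qed

text \<open>The choice maximizes every summand over its interval, hence also over the box without the linear
constraint.\<close>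

lemma endpoint_choice_optimal:
  assumes q: "\<And>l. l < c \<Longrightarrow> q l > 0"
    and box: "\<And>l. l < c \<Longrightarrow> lo $ l \<le> hi $ l"
    and p_def: "p = vec c (\<lambda>l. if v l / q l - lo $ l \<le> hi $ l then hi $ l else lo $ l)"
    and k: "k \<le> (\<Sum>l<c. b l * p $ l)"
  shows "optimal_on (feasible_set c b k lo hi) (objective c q v) p"
  unfolding optimal_on_def
proof (intro conjI ballI)
  show "p \<in> feasible_set c b k lo hi"
    using k box by (auto simp: feasible_set_def p_def)
next
  fix p' assume "p' \<in> feasible_set c b k lo hi"
  then have "lo $ l \<le> p' $ l" "p' $ l \<le> hi $ l" if "l < c" for l
    using that by (auto simp: feasible_set_def)
  then show "objective c q v p' \<le> objective c q v p"
    unfolding objective_def p_def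
    by (intro sum_mono)
       (auto simp: not_le intro: quadratic_le_right_end quadratic_le_left_end q)
qed

lemma optimal_with_coordinate_at_upper_bound:
  assumes nonempty: "feasible_set c b k lo hi \<noteq> {}"
    and l: "l < c" and q: "q l > 0" and b: "b l \<ge> 0"
    and hi: "v l / q l - lo $ l \<le> hi $ l"
  shows "\<exists>p. optimal_on (feasible_set c b k lo hi) (objective c q v) p \<and> p $ l = hi $ l"
proof -
  obtain p where p: "p \<in> feasible_set c b k lo hi"
    and p_max: "\<And>p'. p' \<in> feasible_set c b k lo hi \<Longrightarrow> objective c q v p' \<le> objective c q v p"
    using optimal_exists[OF nonempty, of q v] by (auto simp: optimal_on_def)
  define p' where "p' = vec c (\<lambda>i. if i = l then hi $ l else p $ i)"
  have range: "lo $ i \<le> p $ i" "p $ i \<le> hi $ i" if "i < c" for i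
    using p that by (auto simp: feasible_set_def)
  have "(\<Sum>i<c. b i * p $ i) \<le> (\<Sum>i<c. b i * p' $ i)"
    by (intro sum_mono) (auto simp: p'_def range l intro!: mult_left_mono b)
  moreover have "lo $ l \<le> hi $ l"
    using range[OF l] by linarith
  ultimately have "p' \<in> feasible_set c b k lo hi"
    using p by (auto simp: feasible_set_def p'_def)
  moreover have "objective c q v p \<le> objective c q v p'"
    unfolding objective_def
    by (intro sum_mono) (auto simp: p'_def range quadratic_le_right_end[OF q _ _ hi])
  ultimately have "optimal_on (feasible_set c b k lo hi) (objective c q v) p'"
    using p_max unfolding optimal_on_def by (meson order_trans)
  then show ?thesis
    using l by (auto simp: p'_def)
qed

text \<open>A small step from \<open>p\<close> in both senses of a constraint-preserving direction stays feasible; by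
strict convexity the two objective values add up to more than twice the value at \<open>p\<close>.\<close>

lemma optimal_no_two_interior_coordinates:
  assumes opt: "optimal_on (feasible_set c b k lo hi) (objective c q v) p"
    and q: "\<And>l. l < c \<Longrightarrow> q l > 0"
    and ij: "i < c" "j < c" "i \<noteq> j"
    and i: "lo $ i < p $ i" "p $ i < hi $ i"
    and j: "lo $ j < p $ j" "p $ j < hi $ j"
  shows False
proof -
  \<comment> \<open>Two free coordinates against one linear constraint leave a direction that preserves it.\<close>
  obtain d e where de: "b i * d + b j * e = 0" "d \<noteq> 0 \<or> e \<noteq> 0"
  proof (cases "b i = 0")
    case True
    then show ?thesis using that[of 1 0] by simp
  next
    case False
    then show ?thesis using that[of "- b j" "b i"] by simp
  qed
  define gap where "gap = Min {p $ i - lo $ i, hi $ i - p $ i, p $ j - lo $ j, hi $ j - p $ j}"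
  define t where "t = gap / (\<bar>d\<bar> + \<bar>e\<bar>)"
  have "gap > 0" using i j by (simp add: gap_def)
  have pos: "\<bar>d\<bar> + \<bar>e\<bar> > 0" using de by linarith
  with \<open>gap > 0\<close> have "t > 0" by (simp add: t_def)
  have "gap = t * \<bar>d\<bar> + t * \<bar>e\<bar>"
    using pos by (simp add: t_def flip: distrib_left add_divide_distrib)
  with \<open>t > 0\<close> have "t * \<bar>d\<bar> \<le> gap" "t * \<bar>e\<bar> \<le> gap"
    by simp_all
  then have td: "\<bar>t * d\<bar> \<le> gap" and te: "\<bar>t * e\<bar> \<le> gap"
    using \<open>t > 0\<close> by (simp_all add: abs_mult)
  define x where "x l = (if l = i then t * d else if l = j then t * e else 0)" for l
  define y where "y s = vec c (\<lambda>l. p $ l + s * x l)" for s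
  have on_ij: "(\<Sum>l<c. g l * x l ^ m) = g i * x i ^ m + g j * x j ^ m"
    if "m > 0" for g :: "nat \<Rightarrow> real" and m
  proof -
    have "(\<Sum>l<c. g l * x l ^ m) = (\<Sum>l\<in>{i, j}. g l * x l ^ m)"
      using ij that by (intro sum.mono_neutral_right) (auto simp: x_def)
    then show ?thesis using ij by simp
  qed
  have "(\<Sum>l<c. b l * x l) = t * (b i * d + b j * e)"
    using on_ij[of 1 b] ij by (simp add: x_def algebra_simps)
  then have bx: "(\<Sum>l<c. b l * x l) = 0"
    using de by simp
  have p: "p \<in> feasible_set c b k lo hi"
    using opt by (simp add: optimal_on_def)
  have y_feasible: "y s \<in> feasible_set c b k lo hi" if s: "s = 1 \<or> s = -1" for s
  proof -
    have "(\<Sum>l<c. b l * (p $ l + s * x l)) = (\<Sum>l<c. b l * p $ l) + s * (\<Sum>l<c. b l * x l)"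
      by (simp add: sum.distrib sum_distrib_left algebra_simps)
    moreover have "lo $ l \<le> p $ l + s * x l \<and> p $ l + s * x l \<le> hi $ l" if "l < c" for l
    proof (cases "l = i \<or> l = j")
      case True
      then have "\<bar>x l\<bar> \<le> gap" using td te by (auto simp: x_def)
      moreover have "gap \<le> p $ l - lo $ l" "gap \<le> hi $ l - p $ l"
        using True by (auto simp: gap_def)
      ultimately show ?thesis using s by auto
    next
      case False
      then show ?thesis using p that by (auto simp: x_def feasible_set_def)
    qed
    ultimately show ?thesis
      using p bx by (simp add: y_def feasible_set_def)
  qed
  have "objective c q v (y 1) + objective c q v (y (-1)) - 2 * objective c q v p
      = 2 * (\<Sum>l<c. q l * (x l)\<^sup>2)"
    unfolding objective_def y_def sum_distrib_left sum_subtractf[symmetric] sum.distrib[symmetric]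
    by (intro sum.cong) (auto simp: power2_eq_square algebra_simps)
  moreover have "(\<Sum>l<c. q l * (x l)\<^sup>2) = q i * (t * d)\<^sup>2 + q j * (t * e)\<^sup>2"
    using on_ij[of 2 q] ij by (simp add: x_def)
  moreover have "q i * (t * d)\<^sup>2 + q j * (t * e)\<^sup>2 > 0"
    using de(2) q[OF ij(1)] q[OF ij(2)] \<open>t > 0\<close>
    by (auto intro: add_pos_nonneg add_nonneg_pos)
  ultimately have "2 * objective c q v p < objective c q v (y 1) + objective c q v (y (-1))"
    by linarith
  moreover have "objective c q v (y 1) \<le> objective c q v p" "objective c q v (y (-1)) \<le> objective c q v p"
    using opt y_feasible by (auto simp: optimal_on_def)
  ultimately show False by linarith
qed

lemma optimal_card_endpoint_coordinates:
  assumes opt: "optimal_on (feasible_set c b k lo hi) (objective c q v) p"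
    and q: "\<And>l. l < c \<Longrightarrow> q l > 0"
  shows "c - 1 \<le> card {l. l < c \<and> p $ l \<in> {lo $ l, hi $ l}}"
proof -
  let ?E = "{l. l < c \<and> p $ l \<in> {lo $ l, hi $ l}}"
  define I where "I = {..<c} - ?E"
  have "lo $ l < p $ l \<and> p $ l < hi $ l" if "l \<in> I" for l
    using opt that by (force simp: I_def optimal_on_def feasible_set_def)
  then have "i = j" if "i \<in> I" "j \<in> I" for i j
    using optimal_no_two_interior_coordinates[OF opt q, of i j] that by (auto simp: I_def)
  then have "card I \<le> 1"
    using card_le_Suc0_iff_eq[of I] by (simp add: I_def)
  moreover have "card I = c - card ?E"
    unfolding I_def by (subst card_Diff_subset) auto
  ultimately show ?thesis by linarith
qed

section \<open>Spectral radius, injectivity and comparison\<close>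

lemma mult_mat_vec_nth:
  assumes "A \<in> carrier_mat n m" "z \<in> carrier_vec m" "i < n"
  shows "(A *\<^sub>v z) $ i = (\<Sum>j<m. A $$ (i, j) * z $ j)"
  using assms by (auto simp: scalar_prod_def lessThan_atLeast0)

lemma smult_mat_mult_vec:
  fixes A :: "real mat"
  assumes "A \<in> carrier_mat n m" "z \<in> carrier_vec m"
  shows "(s \<cdot>\<^sub>m A) *\<^sub>v z = s \<cdot>\<^sub>v (A *\<^sub>v z)"
  using assms by (intro eq_vecI) auto

lemma scalar_prod_self_pos:
  fixes w :: "real vec"
  assumes w: "w \<in> carrier_vec m" and "w \<noteq> 0\<^sub>v m"
  shows "0 < w \<bullet> w"
proof -
  obtain i where "i < m" "w $ i \<noteq> 0"
    using assms by force
  then have "0 < w $ i * w $ i"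
    by (metis not_square_less_zero linorder_neqE mult_eq_0_iff)
  with \<open>i < m\<close> w show ?thesis
    unfolding scalar_prod_def by (intro sum_pos2[of _ i]) auto
qed

lemma eigenvalue_le_real_spectral_radius:
  assumes G: "G \<in> carrier_mat n n" and n: "n > 0"
    and ev: "eigenvalue (map_mat complex_of_real G) a"
  shows "cmod a \<le> real_spectral_radius G"
  unfolding real_spectral_radius_def
  by (rule spectral_radius_mem_max(2)[OF _ n]) (use G ev in \<open>auto simp: spectrum_def\<close>)

lemma real_spectral_radius_nonneg:
  assumes G: "G \<in> carrier_mat n n" and n: "n > 0"
  shows "0 \<le> real_spectral_radius G"
proof -
  obtain a where "a \<in> spectrum (map_mat complex_of_real G)"
    using spectrum_non_empty[of "map_mat complex_of_real G" n] G n by auto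
  then show ?thesis
    using eigenvalue_le_real_spectral_radius[OF G n, of a]
    by (auto simp: spectrum_def intro: order_trans[OF norm_ge_zero])
qed

text \<open>A nonzero solution would be an eigenvector of \<open>G\<close> for \<open>s / t\<close>, whose modulus exceeds the
spectral radius.\<close>

lemma shift_injective:
  assumes G: "G \<in> carrier_mat n n" and s: "s > 0"
    and small: "\<bar>t\<bar> / s * real_spectral_radius G < 1"
    and z: "z \<in> carrier_vec n"
    and fix_z: "\<And>i. i < n \<Longrightarrow> s * z $ i = t * (G *\<^sub>v z) $ i"
  shows "z = 0\<^sub>v n"
proof (rule ccontr)
  assume nz: "z \<noteq> 0\<^sub>v n"
  then have n: "n > 0"
    using z by (cases n) auto
  obtain i where i: "i < n" "z $ i \<noteq> 0"
    using nz z by force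
  then have "t \<noteq> 0"
    using fix_z[of i] s by auto
  have "G *\<^sub>v z = (s / t) \<cdot>\<^sub>v z"
  proof (rule eq_vecI)
    fix j assume "j < dim_vec ((s / t) \<cdot>\<^sub>v z)"
    then have "j < n" using z by simp
    then show "(G *\<^sub>v z) $ j = ((s / t) \<cdot>\<^sub>v z) $ j"
      using fix_z[of j] z \<open>t \<noteq> 0\<close> by (simp add: field_simps)
  qed (use G z in auto)
  then have "eigenvalue G (s / t)"
    using G z nz unfolding eigenvalue_def eigenvector_def by auto
  then have "eigenvalue (map_mat complex_of_real G) (complex_of_real (s / t))"
    by (rule of_real_hom.eigenvalue_hom[OF G])
  from eigenvalue_le_real_spectral_radius[OF G n this]
  have "s / \<bar>t\<bar> \<le> real_spectral_radius G"
    using s by (simp add: norm_divide)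
  then have "1 \<le> \<bar>t\<bar> / s * real_spectral_radius G"
    using s \<open>t \<noteq> 0\<close> by (simp add: field_simps)
  with small show False by simp
qed

text \<open>The eigenvalues of \<open>s G\<close> are \<open>s\<close> times those of \<open>G\<close>, so its spectral radius is below 1, and the
Jordan normal form bounds the powers.\<close>

lemma scaled_powers_bounded:
  assumes G: "G \<in> carrier_mat n n" and n: "n > 0" and s: "s > 0"
    and small: "s * real_spectral_radius G < 1"
  shows "\<exists>C. \<forall>k. \<forall>i<n. \<forall>j<n. \<bar>((s \<cdot>\<^sub>m G) ^\<^sub>m k) $$ (i, j)\<bar> \<le> C"
proof -
  let ?B = "map_mat complex_of_real (s \<cdot>\<^sub>m G)"
  have B: "?B \<in> carrier_mat n n" using G by simp
  obtain a where a: "a \<in> spectrum ?B" "spectral_radius ?B = cmod a"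
    using spectral_radius_mem_max(1)[OF B n] by auto
  then obtain z where z: "z \<in> carrier_vec n" "z \<noteq> 0\<^sub>v n" "?B *\<^sub>v z = a \<cdot>\<^sub>v z"
    using G unfolding spectrum_def eigenvalue_def eigenvector_def by auto
  have "map_mat complex_of_real G *\<^sub>v z = (a / complex_of_real s) \<cdot>\<^sub>v z"
  proof (rule eq_vecI)
    fix i assume "i < dim_vec ((a / complex_of_real s) \<cdot>\<^sub>v z)"
    then have i: "i < n" using z by simp
    have "a * z $ i = (?B *\<^sub>v z) $ i"
      using z i by simp
    also have "\<dots> = of_real s * (map_mat complex_of_real G *\<^sub>v z) $ i"
      using mult_mat_vec_nth[OF B z(1) i]
        mult_mat_vec_nth[of "map_mat complex_of_real G" n n z i] G z i
      by (simp add: sum_distrib_left mult.assoc)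
    finally show "(map_mat complex_of_real G *\<^sub>v z) $ i = ((a / complex_of_real s) \<cdot>\<^sub>v z) $ i"
      using s i z by (simp add: field_simps)
  qed (use G z in auto)
  then have "eigenvalue (map_mat complex_of_real G) (a / complex_of_real s)"
    using z G unfolding eigenvalue_def eigenvector_def by auto
  from eigenvalue_le_real_spectral_radius[OF G n this]
  have "cmod a \<le> s * real_spectral_radius G"
    using s by (simp add: norm_divide field_simps)
  then have "spectral_radius ?B < 1"
    using a small by simp
  then obtain C where C: "\<And>k. norm_bound (?B ^\<^sub>m k) C"
    using spectral_radius_jnf_norm_bound_less_1_upper_triangular[OF B] by blast
  have "\<bar>((s \<cdot>\<^sub>m G) ^\<^sub>m k) $$ (i, j)\<bar> \<le> C" if "i < n" "j < n" for i j k
  proof -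
    have sG: "s \<cdot>\<^sub>m G \<in> carrier_mat n n" using G by simp
    have "(?B ^\<^sub>m k) $$ (i, j) = complex_of_real (((s \<cdot>\<^sub>m G) ^\<^sub>m k) $$ (i, j))"
      using that G
      unfolding of_real_hom.mat_hom_pow[OF sG, symmetric] by auto
    then show ?thesis
      using C[of k] that pow_carrier_mat[OF B, of k]
      unfolding norm_bound_def by (metis carrier_matD norm_of_real)
  qed
  then show ?thesis by blast
qed

text \<open>The comparison principle. Since \<open>a G\<close> is entrywise nonnegative, the hypothesis can be iterated
to \<open>z \<ge> (a G)\<^sup>k z\<close>, and the right-hand side tends to 0.\<close>

lemma nonneg_of_supersolution:
  assumes G: "G \<in> carrier_mat n n"
    and G_nonneg: "\<And>i j. i < n \<Longrightarrow> j < n \<Longrightarrow> 0 \<le> G $$ (i, j)"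
    and a: "a \<ge> 0" and small: "a * real_spectral_radius G < 1"
    and z: "z \<in> carrier_vec n"
    and super: "\<And>i. i < n \<Longrightarrow> a * (G *\<^sub>v z) $ i \<le> z $ i"
    and i: "i < n"
  shows "0 \<le> z $ i"
proof -
  have n: "n > 0" using i by simp
  define \<rho> where "\<rho> = real_spectral_radius G"
  have "\<rho> \<ge> 0"
    unfolding \<rho>_def by (rule real_spectral_radius_nonneg[OF G n])
  \<comment> \<open>Splitting \<open>a\<close> as \<open>s * r\<close> with \<open>r < 1\<close> and still \<open>s * \<rho> < 1\<close> keeps the powers of
    \<open>s G\<close> bounded and leaves the factor \<open>r ^ k\<close>, which tends to 0.\<close>
  obtain s r where s: "s > 0" "s * \<rho> < 1" and r: "0 \<le> r" "r < 1" and a_eq: "a = s * r"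
  proof -
    obtain s where "a < s" "s * \<rho> < 1"
    proof (cases "\<rho> = 0")
      case True
      then show ?thesis using that[of "a + 1"] by simp
    next
      case False
      then have "a < 1 / \<rho>"
        using small \<open>\<rho> \<ge> 0\<close> by (simp add: \<rho>_def field_simps)
      then obtain s where "a < s" "s < 1 / \<rho>" using dense by blast
      then show ?thesis using that[of s] \<open>\<rho> \<ge> 0\<close> False by (simp add: field_simps)
    qed
    then show ?thesis using that[of s "a / s"] a by simp
  qed
  define B where "B = s \<cdot>\<^sub>m G"
  have B: "B \<in> carrier_mat n n" using G by (simp add: B_def)
  have B_nonneg: "0 \<le> B $$ (i, j)" if "i < n" "j < n" for i j
    using G_nonneg that s G by (simp add: B_def)
  have Bk: "B ^\<^sub>m k \<in> carrier_mat n n" for k using B by simp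
  have pow_Suc: "(B ^\<^sub>m Suc k) $$ (i, j) = (\<Sum>l<n. (B ^\<^sub>m k) $$ (i, l) * B $$ (l, j))"
    if "i < n" "j < n" for i j k
    using that B Bk[of k] by (simp add: scalar_prod_def lessThan_atLeast0)
  have pow_nonneg: "0 \<le> (B ^\<^sub>m k) $$ (i, j)" if "i < n" "j < n" for i j k
    using that
  proof (induction k arbitrary: j)
    case 0
    then show ?case using B by simp
  next
    case (Suc k)
    then show ?case
      unfolding pow_Suc[OF Suc.prems] by (intro sum_nonneg mult_nonneg_nonneg B_nonneg) auto
  qed
  have super': "r * (\<Sum>j<n. B $$ (l, j) * z $ j) \<le> z $ l" if "l < n" for l
  proof -
    have "a * (G *\<^sub>v z) $ l = r * (\<Sum>j<n. B $$ (l, j) * z $ j)"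
      unfolding mult_mat_vec_nth[OF G z that] sum_distrib_left B_def
      using G that by (intro sum.cong) (auto simp: a_eq mult_ac)
    then show ?thesis using super[OF that] by simp
  qed
  have iterate: "r ^ k * (\<Sum>j<n. (B ^\<^sub>m k) $$ (i, j) * z $ j) \<le> z $ i" for k
  proof (induction k)
    case 0
    have "(\<Sum>j<n. (B ^\<^sub>m 0) $$ (i, j) * z $ j) = (\<Sum>j<n. if j = i then z $ i else 0)"
      using B i by (intro sum.cong) auto
    then show ?case using i by simp
  next
    case (Suc k)
    have "(\<Sum>j<n. (B ^\<^sub>m Suc k) $$ (i, j) * z $ j)
        = (\<Sum>j<n. \<Sum>l<n. (B ^\<^sub>m k) $$ (i, l) * B $$ (l, j) * z $ j)"
      using i by (intro sum.cong) (auto simp del: pow_mat.simps simp: pow_Suc sum_distrib_right)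
    also have "\<dots> = (\<Sum>l<n. (B ^\<^sub>m k) $$ (i, l) * (\<Sum>j<n. B $$ (l, j) * z $ j))"
      by (subst sum.swap) (simp add: sum_distrib_left mult.assoc)
    finally have "r ^ Suc k * (\<Sum>j<n. (B ^\<^sub>m Suc k) $$ (i, j) * z $ j)
        = r ^ k * (\<Sum>l<n. (B ^\<^sub>m k) $$ (i, l) * (r * (\<Sum>j<n. B $$ (l, j) * z $ j)))"
      by (simp del: pow_mat.simps add: sum_distrib_left mult_ac)
    also have "\<dots> \<le> r ^ k * (\<Sum>l<n. (B ^\<^sub>m k) $$ (i, l) * z $ l)"
      using r i by (intro mult_left_mono sum_mono super' pow_nonneg) auto
    also note Suc.IH
    finally show ?case .
  qed
  obtain C where C: "\<And>k i j. i < n \<Longrightarrow> j < n \<Longrightarrow> \<bar>(B ^\<^sub>m k) $$ (i, j)\<bar> \<le> C"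
    using scaled_powers_bounded[OF G n s(1)] s(2) unfolding B_def \<rho>_def by blast
  define D where "D = (\<Sum>j<n. C * \<bar>z $ j\<bar>)"
  have lower: "- (r ^ k * D) \<le> z $ i" for k
  proof -
    have "\<bar>\<Sum>j<n. (B ^\<^sub>m k) $$ (i, j) * z $ j\<bar> \<le> D"
      unfolding D_def using i C
      by (intro order_trans[OF sum_abs] sum_mono) (auto simp: abs_mult intro!: mult_right_mono)
    then have "- D \<le> (\<Sum>j<n. (B ^\<^sub>m k) $$ (i, j) * z $ j)" by linarith
    then have "r ^ k * (- D) \<le> r ^ k * (\<Sum>j<n. (B ^\<^sub>m k) $$ (i, j) * z $ j)"
      using r by (intro mult_left_mono) auto
    with iterate[of k] show ?thesis by simp
  qed
  have "(\<lambda>k. - (r ^ k * D)) \<longlonglongrightarrow> - (0 * D)"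
    using r by (intro tendsto_intros LIMSEQ_power_zero) auto
  then have "(\<lambda>k. - (r ^ k * D)) \<longlonglongrightarrow> 0" by simp
  then show ?thesis
    by (rule LIMSEQ_le_const2) (use lower in auto)
qed

section \<open>Symmetric inverses of shifted matrices\<close>

lemma mat_inv_of_injective:
  assumes K: "K \<in> carrier_mat m m"
    and inj: "\<And>z. z \<in> carrier_vec m \<Longrightarrow> K *\<^sub>v z = 0\<^sub>v m \<Longrightarrow> z = 0\<^sub>v m"
  shows "mat_inv K \<in> carrier_mat m m" "K * mat_inv K = 1\<^sub>m m" "mat_inv K * K = 1\<^sub>m m"
proof -
  have "det K \<noteq> 0"
    using det_0_iff_vec_prod_zero_field[OF K] inj by blast
  then have "K \<in> Units (ring_mat TYPE(real) m ())"
    by (rule det_non_zero_imp_unit[OF K])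
  then obtain L where L: "mat_inverse K = Some L"
    using mat_inverse(1)[OF K, where b = "()"] by (cases "mat_inverse K") auto
  with mat_inverse(2)[OF K this] 
  show "mat_inv K \<in> carrier_mat m m" "K * mat_inv K = 1\<^sub>m m" "mat_inv K * K = 1\<^sub>m m"
    by (auto simp: mat_inv_def)
qed

lemma mat_inv_symmetric:
  assumes K: "K \<in> carrier_mat m m"
    and inj: "\<And>z. z \<in> carrier_vec m \<Longrightarrow> K *\<^sub>v z = 0\<^sub>v m \<Longrightarrow> z = 0\<^sub>v m"
    and sym: "transpose_mat K = K"
  shows "transpose_mat (mat_inv K) = mat_inv K"
proof -
  note inv = mat_inv_of_injective[OF K inj]
  let ?L = "mat_inv K"
  have L: "?L \<in> carrier_mat m m" and LT: "transpose_mat ?L \<in> carrier_mat m m"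
    using inv(1) by auto
  have "transpose_mat ?L * K = 1\<^sub>m m"
    using arg_cong[OF inv(2), of transpose_mat] transpose_mult[OF K L] sym by simp
  then have "transpose_mat ?L * K * ?L = ?L"
    using L by simp
  then show ?thesis
    using assoc_mult_mat[OF LT K L] inv(2) LT by simp
qed

lemma ones_carrier [simp]: "ones m \<in> carrier_vec m"
  by (simp add: ones_def)

lemma ones_square_ones:
  assumes M: "M \<in> carrier_mat m m" and sym: "transpose_mat M = M"
  shows "ones m \<bullet> ((M ^\<^sub>m 2) *\<^sub>v ones m) = (M *\<^sub>v ones m) \<bullet> (M *\<^sub>v ones m)"
proof -
  have "(M ^\<^sub>m 2) *\<^sub>v ones m = M *\<^sub>v (M *\<^sub>v ones m)"
    using M by (simp add: numeral_2_eq_2)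
  then show ?thesis
    using transpose_vec_mult_scalar[OF M, of "M *\<^sub>v ones m" "ones m"] M sym
    by simp
qed

lemma shift_mult_nth:
  fixes A :: "real mat"
  assumes "A \<in> carrier_mat m m" "z \<in> carrier_vec m" "i < m"
  shows "((s \<cdot>\<^sub>m 1\<^sub>m m - t \<cdot>\<^sub>m A) *\<^sub>v z) $ i = s * z $ i - t * (A *\<^sub>v z) $ i"
proof -
  have "(\<Sum>j<m. s * (if i = j then 1 else 0) * z $ j) = (\<Sum>j<m. if j = i then s * z $ i else 0)"
    by (intro sum.cong) auto
  moreover have "s \<cdot>\<^sub>m 1\<^sub>m m - t \<cdot>\<^sub>m A \<in> carrier_mat m m"
    by (intro minus_carrier_mat smult_carrier_mat assms)
  ultimately show ?thesis
    using assms mult_mat_vec_nth[of "s \<cdot>\<^sub>m 1\<^sub>m m - t \<cdot>\<^sub>m A" m m z i] mult_mat_vec_nth[of A m m z i]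
    by (simp add: left_diff_distrib sum_subtractf sum_distrib_left mult.assoc)
qed

text \<open>The last conclusion is the equation \<open>(s I - t A) M 1 = 1\<close> in the form in which it is compared
between different shifts. Injectivity is a hypothesis because it is obtained in two ways: from the
spectral radius for the whole graph, by extension with zeros for a component.\<close>

lemma shift_inverse:
  assumes A: "A \<in> carrier_mat m m" and sym: "transpose_mat A = A"
    and inj: "\<forall>z\<in>carrier_vec m. (\<forall>i<m. s * z $ i = t * (A *\<^sub>v z) $ i) \<longrightarrow> z = 0\<^sub>v m"
    and M_def: "M = mat_inv (s \<cdot>\<^sub>m 1\<^sub>m m - t \<cdot>\<^sub>m A)"
  shows "M \<in> carrier_mat m m" "transpose_mat M = M"
    and "\<And>i. i < m \<Longrightarrow> s * (M *\<^sub>v ones m) $ i = 1 + t * (A *\<^sub>v (M *\<^sub>v ones m)) $ i"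
proof -
  let ?K = "s \<cdot>\<^sub>m 1\<^sub>m m - t \<cdot>\<^sub>m A"
  have K: "?K \<in> carrier_mat m m"
    by (intro minus_carrier_mat smult_carrier_mat A)
  have K_inj: "z = 0\<^sub>v m" if z: "z \<in> carrier_vec m" "?K *\<^sub>v z = 0\<^sub>v m" for z
  proof -
    have "s * z $ i = t * (A *\<^sub>v z) $ i" if "i < m" for i
      using shift_mult_nth[OF A z(1) that, of s t] z(2) that by simp
    with inj z(1) show ?thesis by blast
  qed
  show M: "M \<in> carrier_mat m m"
    unfolding M_def by (rule mat_inv_of_injective[OF K K_inj])
  have "A $$ (j, i) = A $$ (i, j)" if "i < m" "j < m" for i j
    using arg_cong[OF sym, of "\<lambda>B. B $$ (i, j)"] that A by simp
  then have K_sym: "transpose_mat ?K = ?K"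
    using A by (intro eq_matI) auto
  show "transpose_mat M = M"
    unfolding M_def by (rule mat_inv_symmetric[OF K K_inj K_sym])
  have Mo: "M *\<^sub>v ones m \<in> carrier_vec m" using M by simp
  have "?K *\<^sub>v (M *\<^sub>v ones m) = (?K * M) *\<^sub>v ones m"
    by (rule assoc_mult_mat_vec[OF K M, symmetric]) simp
  also have "?K * M = 1\<^sub>m m"
    unfolding M_def by (rule mat_inv_of_injective[OF K K_inj])
  finally have K_Mo: "?K *\<^sub>v (M *\<^sub>v ones m) = ones m"
    by simp
  show "s * (M *\<^sub>v ones m) $ i = 1 + t * (A *\<^sub>v (M *\<^sub>v ones m)) $ i" if "i < m" for i
    using shift_mult_nth[OF A Mo that, of s t] that unfolding K_Mo by (simp add: ones_def)
qed

section \<open>Restriction to a connected component\<close>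

lemma bij_betw_pick:
  assumes "finite S"
  shows "bij_betw (pick S) {..<card S} S"
proof (rule bij_betwI[where g = "\<lambda>i. card {a \<in> S. a < i}"])
  show "(\<lambda>i. card {a \<in> S. a < i}) \<in> S \<rightarrow> {..<card S}"
    using assms by (auto intro!: psubset_card_mono)
qed (auto simp: pick_in_set card_pick pick_card_in_set)

lemma restrict_mat_carrier:
  assumes "G \<in> carrier_mat n n" "S \<subseteq> {..<n}"
  shows "restrict_mat G S \<in> carrier_mat (card S) (card S)"
proof -
  have "{i. i < n \<and> i \<in> S} = S" using assms by auto
  then show ?thesis
    using assms by (auto simp: restrict_mat_def dim_submatrix)
qed

lemma restrict_mat_nth:
  assumes "G \<in> carrier_mat n n" "S \<subseteq> {..<n}" "i < card S" "j < card S"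
  shows "restrict_mat G S $$ (i, j) = G $$ (pick S i, pick S j)"
proof -
  have "{i. i < n \<and> i \<in> S} = S" using assms by auto
  then show ?thesis
    using assms by (simp add: restrict_mat_def submatrix_index)
qed

lemma restrict_mat_symmetric:
  assumes G: "G \<in> carrier_mat n n" "transpose_mat G = G" and S: "S \<subseteq> {..<n}"
  shows "transpose_mat (restrict_mat G S) = restrict_mat G S"
proof (rule eq_matI)
  note H = restrict_mat_carrier[OF G(1) S]
  fix i j assume "i < dim_row (restrict_mat G S)" "j < dim_col (restrict_mat G S)"
  then have ij: "i < card S" "j < card S" using H by auto
  have "finite S" using S finite_subset by blast
  with ij S have "pick S i < n" "pick S j < n"
    using pick_in_set[of i S] pick_in_set[of j S] by auto
  then have "G $$ (pick S j, pick S i) = G $$ (pick S i, pick S j)"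
    using arg_cong[OF G(2), of "\<lambda>A. A $$ (pick S i, pick S j)"] G(1) by simp
  then show "transpose_mat (restrict_mat G S) $$ (i, j) = restrict_mat G S $$ (i, j)"
    using H ij by (simp add: restrict_mat_nth[OF G(1) S])
qed (use restrict_mat_carrier[OF G(1) S] in auto)

text \<open>Because the rows of \<open>G\<close> outside \<open>S\<close> vanish on \<open>S\<close>, extending \<open>x\<close> by zero turns a
solution for the restricted matrix into one for \<open>G\<close>.\<close>

lemma shift_injective_restrict:
  assumes G: "G \<in> carrier_mat n n" and S: "S \<subseteq> {..<n}"
    and closed: "\<And>i j. i < n \<Longrightarrow> i \<notin> S \<Longrightarrow> j \<in> S \<Longrightarrow> G $$ (i, j) = 0"
    and s: "s > 0" and small: "\<bar>t\<bar> / s * real_spectral_radius G < 1"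
    and x: "x \<in> carrier_vec (card S)"
    and fix_x: "\<And>k. k < card S \<Longrightarrow> s * x $ k = t * (restrict_mat G S *\<^sub>v x) $ k"
  shows "x = 0\<^sub>v (card S)"
proof -
  define z where "z = vec n (\<lambda>i. if i \<in> S then x $ card {a \<in> S. a < i} else 0)"
  have z: "z \<in> carrier_vec n" by (simp add: z_def)
  have "finite S" using S finite_subset by blast
  note bij = bij_betw_pick[OF this]
  have pick_S: "pick S k \<in> S" "pick S k < n" if "k < card S" for k
    using pick_in_set[of k S] that S by auto
  have z_pick: "z $ pick S k = x $ k" if "k < card S" for k
    using that pick_S[OF that] card_pick[of k S] by (simp add: z_def)
  have Gz: "(G *\<^sub>v z) $ i = (\<Sum>k<card S. G $$ (i, pick S k) * x $ k)" if "i < n" for i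
  proof -
    have "(G *\<^sub>v z) $ i = (\<Sum>j\<in>S. G $$ (i, j) * z $ j)"
      unfolding mult_mat_vec_nth[OF G z that]
      using S by (intro sum.mono_neutral_right) (auto simp: z_def)
    also have "\<dots> = (\<Sum>k<card S. G $$ (i, pick S k) * z $ pick S k)"
      by (rule sum.reindex_bij_betw[OF bij, symmetric])
    finally show ?thesis by (simp add: z_pick)
  qed
  have "s * z $ i = t * (G *\<^sub>v z) $ i" if i: "i < n" for i
  proof (cases "i \<in> S")
    case True
    then obtain l where l: "l < card S" "i = pick S l"
      using bij unfolding bij_betw_def by auto
    have "(restrict_mat G S *\<^sub>v x) $ l = (G *\<^sub>v z) $ i"
      unfolding Gz[OF i] mult_mat_vec_nth[OF restrict_mat_carrier[OF G S] x l(1)]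
      using l by (intro sum.cong) (auto simp: restrict_mat_nth[OF G S])
    then show ?thesis
      using fix_x[OF l(1)] z_pick[OF l(1)] l(2) by simp
  next
    case False
    then have "(G *\<^sub>v z) $ i = 0"
      unfolding Gz[OF i] using i closed pick_S by (intro sum.neutral) auto
    then show ?thesis using False i by (simp add: z_def)
  qed
  then have "z = 0\<^sub>v n"
    by (rule shift_injective[OF G s small z])
  then have "x $ k = 0" if "k < card S" for k
    using z_pick[OF that] pick_S[OF that] by simp
  then show ?thesis using x by (intro eq_vecI) auto
qed

text \<open>A component is a class of mutually reachable vertices, so an edge from one of its vertices ends in
it; symmetry of \<open>G\<close> transfers this to the edges that end in it.\<close>

lemma component_closed:
  assumes G: "adjacency_mat n G" and S: "S \<in> components G"
  shows "S \<subseteq> {..<n}" "S \<noteq> {}"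
    and "\<And>i j. i < n \<Longrightarrow> i \<notin> S \<Longrightarrow> j \<in> S \<Longrightarrow> G $$ (i, j) = 0"
proof -
  have carrier: "G \<in> carrier_mat n n" and sym: "transpose_mat G = G"
    and zero_one: "\<And>i j. i < n \<Longrightarrow> j < n \<Longrightarrow> G $$ (i, j) \<in> {0, 1}"
    using G by (auto simp: adjacency_mat_def)
  obtain x where x: "x < n" and S_eq: "S = {y. y < n \<and> (x, y) \<in> (edges G)\<^sup>*}"
    using S carrier unfolding components_def by (auto elim!: quotientE)
  show S_sub: "S \<subseteq> {..<n}" using S_eq by auto
  show "S \<noteq> {}" using x S_eq by auto
  fix i j assume i: "i < n" "i \<notin> S" and j: "j \<in> S"
  have "j < n" using S_sub j by auto
  then have "G $$ (j, i) = G $$ (i, j)"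
    using arg_cong[OF sym, of "\<lambda>A. A $$ (i, j)"] i carrier by simp
  moreover have "G $$ (j, i) \<noteq> 1"
  proof
    assume "G $$ (j, i) = 1"
    then have "(j, i) \<in> edges G"
      using i \<open>j < n\<close> carrier by (simp add: edges_def)
    then have "i \<in> S"
      using j i S_eq by (auto intro: rtrancl_into_rtrancl)
    with i show False by simp
  qed
  ultimately show "G $$ (i, j) = 0"
    using zero_one[OF i(1) \<open>j < n\<close>] by auto
qed

section \<open>Signs of the coefficients\<close>

text \<open>Dropping one side of the maximum uses that the spectral radius is nonnegative. For \<open>n = 0\<close> it is the
maximum of an empty set and could be anything.\<close>

lemma spec_boundD:
  assumes G: "G \<in> carrier_mat n n" and n: "n > 0"
    and spec: "max u w * real_spectral_radius G < 1"
  shows "u * real_spectral_radius G < 1" "w * real_spectral_radius G < 1"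
  using spec real_spectral_radius_nonneg[OF G n]
  by (meson le_less_trans max.cobounded1 max.cobounded2 mult_right_mono)+

text \<open>Both steps are instances of the comparison principle: \<open>x\<close> is nonnegative, and therefore
\<open>x - y\<close> satisfies \<open>x - y \<ge> a G (x - y) + (a' - a) G x \<ge> a G (x - y)\<close>.\<close>

lemma b_Delta_nonneg:
  assumes graph: "adjacency_mat n G"
    and beta: "0 < \<beta>" "\<beta> < 1" and delta: "\<delta> > 0" and mu: "\<mu> > 0"
    and spec: "max (\<bar>\<delta> + \<mu>\<bar> / (1 + \<beta>)) (\<bar>\<delta> - \<mu>\<bar> / (1 - \<beta>)) * real_spectral_radius G < 1"
    and mu_small: "\<mu> < \<beta> * \<delta>"
    and i: "i < n"
  shows "0 \<le> b_Delta \<beta> \<delta> \<mu> G $ i"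
proof -
  have G: "G \<in> carrier_mat n n" and sym: "transpose_mat G = G"
    and G_nonneg: "\<And>i j. i < n \<Longrightarrow> j < n \<Longrightarrow> 0 \<le> G $$ (i, j)"
    using graph unfolding adjacency_mat_def by force+
  have n: "n > 0" using i by simp
  note small = spec_boundD[OF G n spec]
  have "\<beta> * \<delta> < \<delta>" using beta delta by simp
  then have "\<mu> < \<delta>" using mu_small by linarith
  define a where "a = (\<delta> + \<mu>) / (1 + \<beta>)"
  define a' where "a' = (\<delta> - \<mu>) / (1 - \<beta>)"
  have a_pos: "0 \<le> a" "0 \<le> a'" using \<open>\<mu> < \<delta>\<close> mu delta beta by (simp_all add: a_def a'_def)
  have a_le: "a \<le> a'"
    using mu_small beta by (simp add: a_def a'_def field_simps)
  have a_small: "a * real_spectral_radius G < 1" "a' * real_spectral_radius G < 1"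
    using small \<open>\<mu> < \<delta>\<close> mu delta by (simp_all add: a_def a'_def)
  let ?P = "M_plus \<beta> \<delta> \<mu> G" and ?M = "M_minus \<beta> \<delta> \<mu> G"
  have P_def: "?P = mat_inv ((1 + \<beta>) \<cdot>\<^sub>m 1\<^sub>m n - (\<delta> + \<mu>) \<cdot>\<^sub>m G)"
    and M_def: "?M = mat_inv ((1 - \<beta>) \<cdot>\<^sub>m 1\<^sub>m n - (\<delta> - \<mu>) \<cdot>\<^sub>m G)"
    using G by (simp_all add: M_plus_def M_minus_def)
  have bpos: "0 < 1 + \<beta>" "0 < 1 - \<beta>" using beta by auto
  have P_inj: "\<forall>z\<in>carrier_vec n.
      (\<forall>i<n. (1 + \<beta>) * z $ i = (\<delta> + \<mu>) * (G *\<^sub>v z) $ i) \<longrightarrow> z = 0\<^sub>v n"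
    using shift_injective[OF G bpos(1) small(1)] by blast
  have M_inj: "\<forall>z\<in>carrier_vec n.
      (\<forall>i<n. (1 - \<beta>) * z $ i = (\<delta> - \<mu>) * (G *\<^sub>v z) $ i) \<longrightarrow> z = 0\<^sub>v n"
    using shift_injective[OF G bpos(2) small(2)] by blast
  have P: "?P \<in> carrier_mat n n"
    "\<And>j. j < n \<Longrightarrow> (1 + \<beta>) * (?P *\<^sub>v ones n) $ j = 1 + (\<delta> + \<mu>) * (G *\<^sub>v (?P *\<^sub>v ones n)) $ j"
    by (rule shift_inverse[OF G sym P_inj P_def], assumption?)+
  have M: "?M \<in> carrier_mat n n"
    "\<And>j. j < n \<Longrightarrow> (1 - \<beta>) * (?M *\<^sub>v ones n) $ j = 1 + (\<delta> - \<mu>) * (G *\<^sub>v (?M *\<^sub>v ones n)) $ j"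
    by (rule shift_inverse[OF G sym M_inj M_def], assumption?)+
  define x where "x = ?M *\<^sub>v ones n"
  define y where "y = ?P *\<^sub>v ones n"
  have x: "x \<in> carrier_vec n" and y: "y \<in> carrier_vec n"
    using M(1) P(1) by (simp_all add: x_def y_def)
  have x_eq: "x $ i = 1 / (1 - \<beta>) + a' * (G *\<^sub>v x) $ i" if "i < n" for i
    using M(2)[OF that] bpos unfolding x_def a'_def by (simp add: field_simps)
  have y_eq: "y $ i = 1 / (1 + \<beta>) + a * (G *\<^sub>v y) $ i" if "i < n" for i
    using P(2)[OF that] bpos unfolding y_def a_def by (simp add: field_simps)
  have x_nonneg: "0 \<le> x $ i" if "i < n" for i
  proof (rule nonneg_of_supersolution[OF G G_nonneg a_pos(2) a_small(2) x _ that])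
    show "a' * (G *\<^sub>v x) $ j \<le> x $ j" if "j < n" for j
      using x_eq[OF that] bpos by simp
  qed
  have Gx_nonneg: "0 \<le> (G *\<^sub>v x) $ i" if "i < n" for i
    unfolding mult_mat_vec_nth[OF G x that]
    using that by (intro sum_nonneg mult_nonneg_nonneg G_nonneg x_nonneg) auto
  have "0 \<le> (x - y) $ i"
  proof (rule nonneg_of_supersolution[OF G G_nonneg a_pos(1) a_small(1) _ _ i])
    fix j assume j: "j < n"
    have "(G *\<^sub>v (x - y)) $ j = (G *\<^sub>v x) $ j - (G *\<^sub>v y) $ j"
      using x y j G by (simp add: mult_minus_distrib_mat_vec[OF G x y])
    moreover have "1 / (1 + \<beta>) \<le> 1 / (1 - \<beta>)"
      using beta by (simp add: field_simps)
    moreover have "a * (G *\<^sub>v x) $ j \<le> a' * (G *\<^sub>v x) $ j"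
      by (rule mult_right_mono[OF a_le Gx_nonneg[OF j]])
    ultimately show "a * (G *\<^sub>v (x - y)) $ j \<le> (x - y) $ j"
      using x_eq[OF j] y_eq[OF j] x y j by (simp add: right_diff_distrib)
  qed (use x y in auto)
  moreover have "b_Delta \<beta> \<delta> \<mu> G = x - y"
    using G minus_mult_distrib_mat_vec[OF M(1) P(1), of "ones n"]
    by (simp add: b_Delta_def x_def y_def)
  ultimately show ?thesis by simp
qed

text \<open>By symmetry \<open>1 \<bullet> M\<^sup>2 1 = M 1 \<bullet> M 1\<close>, so \<open>q\<^sub>l\<close> is a positive combination of two squared norms,
and the first of them is nonzero.\<close>

lemma q_comp_pos:
  assumes graph: "adjacency_mat n G" and S: "S \<in> components G"
    and beta: "0 < \<beta>" "\<beta> < 1"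
    and spec: "max (\<bar>\<delta> + \<mu>\<bar> / (1 + \<beta>)) (\<bar>\<delta> - \<mu>\<bar> / (1 - \<beta>)) * real_spectral_radius G < 1"
  shows "0 < q_comp \<beta> \<delta> \<mu> G S"
proof -
  have G: "G \<in> carrier_mat n n" and sym: "transpose_mat G = G"
    using graph by (auto simp: adjacency_mat_def)
  note closed = component_closed[OF graph S]
  have n: "n > 0" using closed(1,2) by auto
  note small = spec_boundD[OF G n spec]
  define m where "m = card S"
  define H where "H = restrict_mat G S"
  have "finite S" using closed(1) finite_subset by blast
  then have m: "m > 0" using closed(2) by (simp add: m_def card_gt_0_iff)
  have H: "H \<in> carrier_mat m m" "transpose_mat H = H"
    unfolding H_def m_def
    using restrict_mat_carrier[OF G closed(1)] restrict_mat_symmetric[OF G sym closed(1)] by auto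
  have bpos: "0 < 1 + \<beta>" "0 < 1 - \<beta>" using beta by auto
  let ?P = "M_plus \<beta> \<delta> \<mu> H" and ?M = "M_minus \<beta> \<delta> \<mu> H"
  have P_def: "?P = mat_inv ((1 + \<beta>) \<cdot>\<^sub>m 1\<^sub>m m - (\<delta> + \<mu>) \<cdot>\<^sub>m H)"
    and M_def: "?M = mat_inv ((1 - \<beta>) \<cdot>\<^sub>m 1\<^sub>m m - (\<delta> - \<mu>) \<cdot>\<^sub>m H)"
    using H by (simp_all add: M_plus_def M_minus_def)
  have P_inj: "\<forall>z\<in>carrier_vec m.
      (\<forall>i<m. (1 + \<beta>) * z $ i = (\<delta> + \<mu>) * (H *\<^sub>v z) $ i) \<longrightarrow> z = 0\<^sub>v m"
    using shift_injective_restrict[OF G closed(1,3) bpos(1) small(1)]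
    by (simp add: m_def H_def)
  have M_inj: "\<forall>z\<in>carrier_vec m.
      (\<forall>i<m. (1 - \<beta>) * z $ i = (\<delta> - \<mu>) * (H *\<^sub>v z) $ i) \<longrightarrow> z = 0\<^sub>v m"
    using shift_injective_restrict[OF G closed(1,3) bpos(2) small(2)]
    by (simp add: m_def H_def)
  have P: "?P \<in> carrier_mat m m" "transpose_mat ?P = ?P"
    "(1 + \<beta>) * (?P *\<^sub>v ones m) $ 0 = 1 + (\<delta> + \<mu>) * (H *\<^sub>v (?P *\<^sub>v ones m)) $ 0"
    using shift_inverse[OF H P_inj P_def] m by auto
  have M: "?M \<in> carrier_mat m m" "transpose_mat ?M = ?M"
    using shift_inverse[OF H M_inj M_def] by auto
  have "?P *\<^sub>v ones m \<noteq> 0\<^sub>v m"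
  proof
    assume "?P *\<^sub>v ones m = 0\<^sub>v m"
    with P(3) m H(1) show False by simp
  qed
  then have "0 < (?P *\<^sub>v ones m) \<bullet> (?P *\<^sub>v ones m)"
    using P(1) by (intro scalar_prod_self_pos[of _ m]) auto
  moreover have "0 \<le> (?M *\<^sub>v ones m) \<bullet> (?M *\<^sub>v ones m)"
    by (simp add: scalar_prod_def sum_nonneg)
  moreover have "q_comp \<beta> \<delta> \<mu> G S = (1 + \<beta>) * ((?P *\<^sub>v ones m) \<bullet> (?P *\<^sub>v ones m))
      + (1 - \<beta>) * ((?M *\<^sub>v ones m) \<bullet> (?M *\<^sub>v ones m))"
  proof -
    have sq: "?P ^\<^sub>m 2 \<in> carrier_mat m m" "?M ^\<^sub>m 2 \<in> carrier_mat m m"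
      using P(1) M(1) by simp_all
    have "Q_mat \<beta> \<delta> \<mu> H *\<^sub>v ones m
        = (1 + \<beta>) \<cdot>\<^sub>v ((?P ^\<^sub>m 2) *\<^sub>v ones m) + (1 - \<beta>) \<cdot>\<^sub>v ((?M ^\<^sub>m 2) *\<^sub>v ones m)"
      using sq unfolding Q_mat_def
      by (simp add: add_mult_distrib_mat_vec[of _ m m] smult_mat_mult_vec[of _ m m])
    moreover have c: "(?P ^\<^sub>m 2) *\<^sub>v ones m \<in> carrier_vec m" "(?M ^\<^sub>m 2) *\<^sub>v ones m \<in> carrier_vec m"
      using sq by (auto intro: mult_mat_vec_carrier)
    ultimately show ?thesis
      unfolding q_comp_def m_def[symmetric] H_def[symmetric]
      by (simp add: scalar_prod_add_distrib[of _ m] scalar_prod_smult_distrib[OF ones_carrier c(1)]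
          scalar_prod_smult_distrib[OF ones_carrier c(2)] ones_square_ones[OF P(1,2)]
          ones_square_ones[OF M(1,2)])
  qed
  ultimately show ?thesis
    using bpos by (simp add: add_pos_nonneg)
qed

section \<open>The pricing problem\<close>

theorem corollary2:
  fixes n c :: nat
    and G :: "real mat"
    and V :: "nat \<Rightarrow> nat set"
    and \<beta> \<delta> \<mu> \<tau> :: real
    and pA0 pB0 pA0c pmax :: "real vec"
  assumes graph: "adjacency_mat n G"
    and comps: "bij_betw V {..<c} (components G)"
    and beta: "0 < \<beta>" "\<beta> < 1"
    and delta: "\<delta> > 0"
    and mu: "\<mu> > 0"
    and tau: "\<tau> \<ge> 0"
    and pA0: "pA0 \<in> carrier_vec n" "\<forall>i<n. pA0 $ i \<ge> 0"
    and pB0: "pB0 \<in> carrier_vec n" "\<forall>i<n. pB0 $ i \<ge> 0"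
    and pA0c: "pA0c \<in> carrier_vec c" "\<forall>l<c. \<forall>i\<in>V l. pA0 $ i = pA0c $ l"
    and pmax: "pmax \<in> carrier_vec c" "\<forall>l<c. pA0c $ l \<le> pmax $ l"
    and feas: "P_feasible c \<beta> \<delta> \<mu> G V pB0 \<tau> pA0c pmax \<noteq> {}"
    and spec: "max (\<bar>\<delta> + \<mu>\<bar> / (1 + \<beta>)) (\<bar>\<delta> - \<mu>\<bar> / (1 - \<beta>)) * real_spectral_radius G < 1"
    and mu_small: "\<mu> < \<beta> * \<delta>"
  shows
    "((\<Sum>l<c. b_comp \<beta> \<delta> \<mu> G (V l) * p_zero_star c \<beta> \<delta> \<mu> G V pB0 pA0c pmax $ l)
         \<ge> k_zero \<beta> \<delta> \<mu> G pB0 \<tau>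
       \<longrightarrow> P_optimal c \<beta> \<delta> \<mu> G V pB0 \<tau> pA0c pmax (p_zero_star c \<beta> \<delta> \<mu> G V pB0 pA0c pmax))
     \<and> (\<forall>l<c. pmax $ l \<ge> v_comp \<beta> \<delta> \<mu> G pB0 (V l) / q_comp \<beta> \<delta> \<mu> G (V l) - pA0c $ l
          \<longrightarrow> (\<exists>p. P_optimal c \<beta> \<delta> \<mu> G V pB0 \<tau> pA0c pmax p
                 \<and> p $ l = p_zero_star c \<beta> \<delta> \<mu> G V pB0 pA0c pmax $ l
                 \<and> p_zero_star c \<beta> \<delta> \<mu> G V pB0 pA0c pmax $ l = pmax $ l))
     \<and> (\<forall>p. P_optimal c \<beta> \<delta> \<mu> G V pB0 \<tau> pA0c pmax p
          \<longrightarrow> card {l. l < c \<and> p $ l \<in> {pA0c $ l, pmax $ l}} \<ge> c - 1)"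
proof -
  let ?q = "\<lambda>l. q_comp \<beta> \<delta> \<mu> G (V l)" and ?v = "\<lambda>l. v_comp \<beta> \<delta> \<mu> G pB0 (V l)"
  let ?b = "\<lambda>l. b_comp \<beta> \<delta> \<mu> G (V l)" and ?k = "k_zero \<beta> \<delta> \<mu> G pB0 \<tau>"
  have V: "V l \<in> components G" if "l < c" for l
    using comps that by (auto simp: bij_betw_def)
  have q: "?q l > 0" if "l < c" for l
    by (rule q_comp_pos[OF graph V[OF that] beta spec])
  have b: "?b l \<ge> 0" if "l < c" for l
    unfolding b_comp_def
    using component_closed(1)[OF graph V[OF that]]
    by (intro sum_nonneg b_Delta_nonneg[OF graph beta delta mu spec mu_small]) auto
  note opt_def = P_optimal_def P_feasible_def
  show ?thesis
  proof (intro conjI impI allI)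
    assume "?k \<le> (\<Sum>l<c. ?b l * p_zero_star c \<beta> \<delta> \<mu> G V pB0 pA0c pmax $ l)"
    then show "P_optimal c \<beta> \<delta> \<mu> G V pB0 \<tau> pA0c pmax (p_zero_star c \<beta> \<delta> \<mu> G V pB0 pA0c pmax)"
      unfolding opt_def using pmax(2)
      by (intro endpoint_choice_optimal q) (auto simp: p_zero_star_def)
  next
    fix l assume l: "l < c" and "?v l / ?q l - pA0c $ l \<le> pmax $ l"
    moreover from this have "p_zero_star c \<beta> \<delta> \<mu> G V pB0 pA0c pmax $ l = pmax $ l"
      by (simp add: p_zero_star_def)
    ultimately show "\<exists>p. P_optimal c \<beta> \<delta> \<mu> G V pB0 \<tau> pA0c pmax p
                 \<and> p $ l = p_zero_star c \<beta> \<delta> \<mu> G V pB0 pA0c pmax $ l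
                 \<and> p_zero_star c \<beta> \<delta> \<mu> G V pB0 pA0c pmax $ l = pmax $ l"
      using optimal_with_coordinate_at_upper_bound[OF feas[unfolded P_feasible_def] l, of ?q ?v]
        q[OF l] b[OF l]
      unfolding opt_def by simp
  next
    fix p assume "P_optimal c \<beta> \<delta> \<mu> G V pB0 \<tau> pA0c pmax p"
    then show "c - 1 \<le> card {l. l < c \<and> p $ l \<in> {pA0c $ l, pmax $ l}}"
      unfolding opt_def using q by (rule optimal_card_endpoint_coordinates)
  qed
qed

end
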